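(* Let $\Phi$ be a generating sequential structure on Banach spaces. Then $\mathcal{O}(\Phi)$ is a surjective operator ideal on Banach spaces. More precisely, $\mathcal{O}(\Phi)=\mathcal{O}(\mathcal{M}^\Phi)$, i.e. $\mathcal{O}(\Phi)(E,F)=\mathcal{O}(\mathcal{M}^\Phi)(E,F)$ for all Banach spaces $E,F$.
   Context: All Banach spaces are over $\mathbb{K}=\mathbb{R}$ or $\mathbb{C}$. $\mathfrak{L}(E,F)$ denotes the space of all continuous linear operators from $E$ to $F$, and $U_E$ the closed unit ball of $E$. Operator ideal (on Banach spaces): a family $\mathfrak{A}=\{\mathfrak{A}(E,F)\}$, indexed by pairs of Banach spaces, such that (OI$_1$) $\mathfrak{A}(E,F)$ is a nonzero vector subspace of $\mathfrak{L}(E,F)$; (OI$_2$) $RTS\in\mathfrak{A}(E_0,F_0)$ whenever $R\in\mathfrak{L}(F,F_0)$, $T\in\mathfrak{A}(E,F)$, $S\in\mathfrak{L}(E_0,E)$. It is surjective if $T\in\mathfrak{A}(E,F)$ whenever $T\in\mathfrak{L}(E,F)$, $S\in\mathfrak{A}(E_0,F)$ and $TU_E\subseteq SU_{E_0}$. Vector sequential structure on $E$: a family $\Phi(E)$ of bounded sequences in $E$ such that $\{ax_n+by_n\}\in\Phi(E)$ whenever $\{x_n\},\{y_n\}\in\Phi(E)$ and $a,b$ are scalars, and every subsequence of a sequence in $\Phi(E)$ belongs to $\Phi(E)$. $\Phi_b(E)$ is the family of all bounded sequences in $E$; $\Phi_{\mathrm{fin}}(E)$ is the family of all bounded sequences contained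 in some finite dimensional subspace of $E$. For vector sequential structures $\Phi$ on $E$ and $\Psi$ on $F$, $\mathfrak{L}(E^\Phi,F^\Psi)$ is the set of all $T\in\mathfrak{L}(E,F)$ such that for each $\{x_n\}\in\Phi$ the sequence $\{Tx_n\}$ has a subsequence in $\Psi$. Generating sequential structure: a family $\Phi=\{\Phi(F): F\text{ a Banach space}\}$ of vector sequential structures with (GS$_1$) $\Phi_{\mathrm{fin}}(F)\subseteq\Phi(F)\subseteq\Phi_b(F)$ for all $F$; (GS$_2$) $\mathfrak{L}(E,F)\subseteq\mathfrak{L}(E^\Phi,F^\Phi)$ for all $E,F$. $\mathcal{O}(\Phi)(E,F):=\mathfrak{L}(E^{\Phi_b},F^\Phi)$: the operators $T\in\mathfrak{L}(E,F)$ such that for every bounded sequence $\{x_n\}$ in $E$, $\{Tx_n\}$ has a subsequence in $\Phi(F)$. $\mathcal{M}^\Phi_{\mathrm{base}}(E)$ is the family of all bounded sets $M\subseteq E$ such that every sequence in $M$ has a subsequence in $\Phi(E)$; $\mathcal{M}^\Phi(E)$ is the family of all bounded sets in $E$ whose circle hull $\mathrm{ch}\,M=\{\lambda x: x\in M,\ |\lambda|\le 1\}$ is in $\mathcal{M}^\Phi_{\mathrm{base}}(E)$. $\mathcal{O}(\mathcal{M}^\Phi)(E,F)$ is the set of all $T\in\mathfrak{L}(E,F)$ sending bounded subsets of $E$ to members of $\mathcal{M}^\Phi(F)$. *)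

theory Defs
  imports "HOL-Algebra.Module" "HOL-Analysis.Abstract_Metric_Spaces"
begin

section \<open>Banach spaces as carrier-based structures\<close>

text \<open>
  Operator ideals and generating sequential structures are families indexed by Banach spaces, so
  Banach spaces have to be values that can be quantified over. They are records whose carrier is a
  subset of a universe type \<open>'a\<close>, which is a type variable in every result and hence
  arbitrary. The scalar field \<open>'k\<close> is meant to be instantiated with \<^typ>\<open>real\<close> or
  \<^typ>\<open>complex\<close>. The fields \<^const>\<open>mult\<close> and \<^const>\<open>one\<close>, inherited from
  the module records of HOL-Algebra, play no role.
\<close>

record ('k, 'a) normed_space = "('k, 'a) module" +
  nrm :: "'a \<Rightarrow> real"

definition scalar_field :: "'k::field ring" where
  "scalar_field = \<lparr>carrier = UNIV, mult = (*), one = 1, zero = 0, add = (+)\<rparr>"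

locale normed_vspace = Module.module scalar_field E
  for E :: "('k::real_normed_field, 'a) normed_space" (structure) +
  assumes nrm_eq_0_iff: "x \<in> carrier E \<Longrightarrow> nrm E x = 0 \<longleftrightarrow> x = \<zero>\<^bsub>E\<^esub>"
    and nrm_smult: "x \<in> carrier E \<Longrightarrow> nrm E (a \<odot>\<^bsub>E\<^esub> x) = norm a * nrm E x"
    and nrm_triangle:
      "\<lbrakk>x \<in> carrier E; y \<in> carrier E\<rbrakk> \<Longrightarrow> nrm E (x \<oplus>\<^bsub>E\<^esub> y) \<le> nrm E x + nrm E y"

text \<open>
  The distance is set to 0 off the carrier because \<^locale>\<open>Metric_space\<close> demands that it be
  nonnegative and symmetric on the whole type.
\<close>

definition ndist :: "('k, 'a) normed_space \<Rightarrow> 'a \<Rightarrow> 'a \<Rightarrow> real" where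
  "ndist E x y = (if x \<in> carrier E \<and> y \<in> carrier E then nrm E (x \<ominus>\<^bsub>E\<^esub> y) else 0)"

abbreviation ntop :: "('k, 'a) normed_space \<Rightarrow> 'a topology" where
  "ntop E \<equiv> Metric_space.mtopology (carrier E) (ndist E)"

locale banach_space = normed_vspace +
  assumes complete: "Metric_space.mcomplete (carrier E) (ndist E)"

lemma (in normed_vspace) nrm_uminus:
  assumes "x \<in> carrier E"
  shows "nrm E (\<ominus>\<^bsub>E\<^esub> x) = nrm E x"
proof -
  have one: "\<one>\<^bsub>scalar_field\<^esub> = (1::'k)" and carr: "carrier scalar_field = (UNIV :: 'k set)"
    by (simp_all add: scalar_field_def)
  have "\<ominus>\<^bsub>E\<^esub> x = (\<ominus>\<^bsub>scalar_field\<^esub> 1) \<odot>\<^bsub>E\<^esub> x"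
    using smult_l_minus[of 1 x] smult_one[of x] assms by (simp add: carr one)
  moreover have "\<ominus>\<^bsub>scalar_field\<^esub> (1::'k) = - 1"
    by (rule R.minus_equality) (simp_all add: scalar_field_def)
  ultimately show ?thesis
    using nrm_smult[OF assms, of "- 1"] by simp
qed

lemma (in normed_vspace) nrm_nonneg:
  assumes "x \<in> carrier E"
  shows "0 \<le> nrm E x"
proof -
  have "nrm E \<zero>\<^bsub>E\<^esub> = 0"
    by (simp add: nrm_eq_0_iff)
  then show ?thesis
    using nrm_triangle[OF assms M.a_inv_closed[OF assms]] nrm_uminus[OF assms] assms
    by (simp add: M.r_neg)
qed

lemma (in normed_vspace) Metric_space_ndist: "Metric_space (carrier E) (ndist E)"
proof
  fix x y
  show "0 \<le> ndist E x y"
    by (simp add: ndist_def nrm_nonneg)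
  show "ndist E x y = ndist E y x"
    using nrm_uminus[of "x \<ominus>\<^bsub>E\<^esub> y"]
    by (auto simp: ndist_def a_minus_def M.minus_add M.a_comm)
next
  fix x y assume "x \<in> carrier E" "y \<in> carrier E"
  then show "ndist E x y = 0 \<longleftrightarrow> x = y"
    using M.minus_equality[of x "\<ominus>\<^bsub>E\<^esub> y"]
    by (auto simp: ndist_def nrm_eq_0_iff a_minus_def M.r_neg)
next
  fix x y z assume c: "x \<in> carrier E" "y \<in> carrier E" "z \<in> carrier E"
  have "x \<ominus>\<^bsub>E\<^esub> z = (x \<ominus>\<^bsub>E\<^esub> y) \<oplus>\<^bsub>E\<^esub> (y \<ominus>\<^bsub>E\<^esub> z)"
    using c by (simp add: a_minus_def M.a_assoc M.r_neg1 M.r_neg2)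
  then show "ndist E x z \<le> ndist E x y + ndist E y z"
    using c nrm_triangle[of "x \<ominus>\<^bsub>E\<^esub> y" "y \<ominus>\<^bsub>E\<^esub> z"] by (simp add: ndist_def)
qed

definition unit_ball :: "('k, 'a) normed_space \<Rightarrow> 'a set" where
  "unit_ball E = {x \<in> carrier E. nrm E x \<le> 1}"

definition nbounded :: "('k, 'a) normed_space \<Rightarrow> 'a set \<Rightarrow> bool" where
  "nbounded E M \<longleftrightarrow> M \<subseteq> carrier E \<and> (\<exists>C. \<forall>x\<in>M. nrm E x \<le> C)"

definition lin_span :: "('k::field, 'a) normed_space \<Rightarrow> 'a set \<Rightarrow> 'a set" where
  "lin_span E B = \<Inter> {W. submodule W scalar_field E \<and> B \<subseteq> W}"

definition fin_dim_subspace :: "('k::field, 'a) normed_space \<Rightarrow> 'a set \<Rightarrow> bool" where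
  "fin_dim_subspace E W \<longleftrightarrow> (\<exists>B. finite B \<and> B \<subseteq> carrier E \<and> W = lin_span E B)"

section \<open>Operators and operator ideals\<close>

text \<open>
  Operators are extensional functions (\<^const>\<open>undefined\<close> off the carrier of the domain), so
  that equality of operators is equality on the domain.
\<close>

definition operators ::
  "('k, 'a) normed_space \<Rightarrow> ('k, 'b) normed_space \<Rightarrow> ('a \<Rightarrow> 'b) set" where
  "operators E F = {T \<in> carrier E \<rightarrow>\<^sub>E carrier F.
     (\<forall>x\<in>carrier E. \<forall>y\<in>carrier E. T (x \<oplus>\<^bsub>E\<^esub> y) = T x \<oplus>\<^bsub>F\<^esub> T y) \<and>
     (\<forall>a. \<forall>x\<in>carrier E. T (a \<odot>\<^bsub>E\<^esub> x) = a \<odot>\<^bsub>F\<^esub> T x) \<and>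
     continuous_map (ntop E) (ntop F) T}"

definition operator_space ::
  "('k, 'a) normed_space \<Rightarrow> ('k, 'b) normed_space \<Rightarrow> ('k, 'a \<Rightarrow> 'b) module" where
  "operator_space E F = \<lparr>carrier = operators E F, mult = undefined, one = undefined,
     zero = (\<lambda>x\<in>carrier E. \<zero>\<^bsub>F\<^esub>),
     add = (\<lambda>S T. \<lambda>x\<in>carrier E. S x \<oplus>\<^bsub>F\<^esub> T x),
     smult = (\<lambda>a T. \<lambda>x\<in>carrier E. a \<odot>\<^bsub>F\<^esub> T x)\<rparr>"

type_synonym ('k, 'a) operator_family =
  "('k, 'a) normed_space \<Rightarrow> ('k, 'a) normed_space \<Rightarrow> ('a \<Rightarrow> 'a) set"

text \<open>
  If \<open>E\<close> or \<open>F\<close> is the zero space, the zero operator is the only operator from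
  \<open>E\<close> to \<open>F\<close>; the requirement that a component be nonzero is therefore imposed exactly
  when both spaces are nonzero.
\<close>

definition operator_ideal :: "('k::real_normed_field, 'a) operator_family \<Rightarrow> bool" where
  "operator_ideal A \<longleftrightarrow>
     (\<forall>E F. banach_space E \<longrightarrow> banach_space F \<longrightarrow>
        submodule (A E F) scalar_field (operator_space E F) \<and>
        (carrier E \<noteq> {\<zero>\<^bsub>E\<^esub>} \<longrightarrow> carrier F \<noteq> {\<zero>\<^bsub>F\<^esub>} \<longrightarrow>
           A E F \<noteq> {\<zero>\<^bsub>operator_space E F\<^esub>})) \<and>
     (\<forall>E F E\<^sub>0 F\<^sub>0. banach_space E \<longrightarrow> banach_space F \<longrightarrow> banach_space E\<^sub>0 \<longrightarrow> banach_space F\<^sub>0 \<longrightarrow>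
        (\<forall>R\<in>operators F F\<^sub>0. \<forall>T\<in>A E F. \<forall>S\<in>operators E\<^sub>0 E.
           compose (carrier E\<^sub>0) R (compose (carrier E\<^sub>0) T S) \<in> A E\<^sub>0 F\<^sub>0))"

definition surjective_operator_ideal ::
  "('k::real_normed_field, 'a) operator_family \<Rightarrow> bool" where
  "surjective_operator_ideal A \<longleftrightarrow> operator_ideal A \<and>
     (\<forall>E E\<^sub>0 F. banach_space E \<longrightarrow> banach_space E\<^sub>0 \<longrightarrow> banach_space F \<longrightarrow>
        (\<forall>T\<in>operators E F. \<forall>S\<in>A E\<^sub>0 F.
           T ` unit_ball E \<subseteq> S ` unit_ball E\<^sub>0 \<longrightarrow> T \<in> A E F))"

section \<open>Sequential structures\<close>

definition all_bounded_seqs :: "('k, 'a) normed_space \<Rightarrow> (nat \<Rightarrow> 'a) set" where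
  "all_bounded_seqs E = {x. nbounded E (range x)}"

definition fin_dim_bounded_seqs :: "('k::field, 'a) normed_space \<Rightarrow> (nat \<Rightarrow> 'a) set" where
  "fin_dim_bounded_seqs E =
     {x \<in> all_bounded_seqs E. \<exists>W. fin_dim_subspace E W \<and> range x \<subseteq> W}"

definition vector_sequential_structure ::
  "('k, 'a) normed_space \<Rightarrow> (nat \<Rightarrow> 'a) set \<Rightarrow> bool" where
  "vector_sequential_structure E X \<longleftrightarrow> X \<subseteq> all_bounded_seqs E \<and>
     (\<forall>x\<in>X. \<forall>y\<in>X. \<forall>a b. (\<lambda>n. a \<odot>\<^bsub>E\<^esub> x n \<oplus>\<^bsub>E\<^esub> b \<odot>\<^bsub>E\<^esub> y n) \<in> X) \<and>
     (\<forall>x\<in>X. \<forall>r. strict_mono r \<longrightarrow> x \<circ> r \<in> X)"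

definition seq_operators ::
  "('k, 'a) normed_space \<Rightarrow> (nat \<Rightarrow> 'a) set \<Rightarrow> ('k, 'b) normed_space \<Rightarrow> (nat \<Rightarrow> 'b) set \<Rightarrow>
    ('a \<Rightarrow> 'b) set" where
  "seq_operators E X F Y =
     {T \<in> operators E F. \<forall>x\<in>X. \<exists>r. strict_mono r \<and> (\<lambda>n. T (x n)) \<circ> r \<in> Y}"

type_synonym ('k, 'a) seq_family = "('k, 'a) normed_space \<Rightarrow> (nat \<Rightarrow> 'a) set"

definition generating_sequential_structure ::
  "('k::real_normed_field, 'a) seq_family \<Rightarrow> bool" where
  "generating_sequential_structure \<Phi> \<longleftrightarrow>
     (\<forall>F. banach_space F \<longrightarrow> vector_sequential_structure F (\<Phi> F) \<and>
        fin_dim_bounded_seqs F \<subseteq> \<Phi> F \<and> \<Phi> F \<subseteq> all_bounded_seqs F) \<and>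
     (\<forall>E F. banach_space E \<longrightarrow> banach_space F \<longrightarrow>
        operators E F \<subseteq> seq_operators E (\<Phi> E) F (\<Phi> F))"

definition ops_of_seqs :: "('k, 'a) seq_family \<Rightarrow> ('k, 'a) operator_family" where
  "ops_of_seqs \<Phi> E F = seq_operators E (all_bounded_seqs E) F (\<Phi> F)"

section \<open>The generating bornology\<close>

definition circle_hull ::
  "('k::real_normed_field, 'a) normed_space \<Rightarrow> 'a set \<Rightarrow> 'a set" where
  "circle_hull E M = {a \<odot>\<^bsub>E\<^esub> x | a x. x \<in> M \<and> norm a \<le> 1}"

definition base_bornology ::
  "('k, 'a) seq_family \<Rightarrow> ('k, 'a) normed_space \<Rightarrow> 'a set set" where
  "base_bornology \<Phi> E =
     {M. nbounded E M \<and> (\<forall>x :: nat \<Rightarrow> 'a. range x \<subseteq> M \<longrightarrow> (\<exists>r. strict_mono r \<and> x \<circ> r \<in> \<Phi> E))}"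

definition seq_bornology ::
  "('k::real_normed_field, 'a) seq_family \<Rightarrow> ('k, 'a) normed_space \<Rightarrow> 'a set set" where
  "seq_bornology \<Phi> E = {M. nbounded E M \<and> circle_hull E M \<in> base_bornology \<Phi> E}"

definition ops_of_bornology ::
  "(('k, 'a) normed_space \<Rightarrow> 'a set set) \<Rightarrow> ('k, 'a) operator_family" where
  "ops_of_bornology \<M> E F = {T \<in> operators E F. \<forall>M. nbounded E M \<longrightarrow> T ` M \<in> \<M> F}"

end

theory Submission
  imports Defs
begin

text \<open>
  Almost everything is extraction of subsequences. Membership in \<^term>\<open>ops_of_seqs \<Phi> E F\<close> asks
  that images of bounded sequences have subsequences in \<^term>\<open>\<Phi> F\<close>. For a sum \<open>S + T\<close> one
  extracts for \<open>S\<close> and then again for \<open>T\<close>, since subsequences stay in \<open>\<Phi> F\<close>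
  (\<open>add_in_ops\<close>). For a product \<open>R T S\<close>, the inner operator \<open>S\<close> preserves bounded sequences and
  the outer operator \<open>R\<close> preserves \<open>\<Phi>\<close> up to a further subsequence (\<open>compose_in_ops\<close>). If \<open>T\<close>
  maps the unit ball into the image of the unit ball under \<open>S\<close>, a bounded sequence is rescaled into
  the unit ball, its image under \<open>T\<close> is lifted to a bounded sequence in the domain of \<open>S\<close>, and
  the rescaling is undone (\<open>surjective_in_ops\<close>). The description by the bornology rests on
  \<open>a \<odot> T x = T (a \<odot> x)\<close>: the circle hull of \<open>T ` M\<close> consists of images of points of the
  bounded circle hull of \<open>M\<close>, while conversely every set lies in its circle hull
  (\<open>ops_of_seqs_eq_ops_of_bornology\<close>).

  That the ideal is nonzero is a fact of a different kind. Operators \<open>x \<mapsto> g x \<odot> y\<close> with a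
  bounded functional \<open>g\<close> send bounded sequences to bounded sequences in a one-dimensional subspace
  and hence belong to the ideal (\<open>rank_one_in_ops\<close>); for a nonzero one a nonzero \<open>g\<close> is needed.
  It comes from the Hahn-Banach theorem, in the form that a minimal sublinear functional is
  additive. This avoids extending partially defined functionals. If \<open>q\<close> is sublinear, then
  \<open>q' x = inf {q (x \<oplus> t \<odot> y) - t * q y | t \<ge> 0}\<close> is a sublinear functional below \<open>q\<close>. If \<open>q\<close> is
  minimal, then \<open>q' = q\<close>, and \<open>t = 1\<close> gives \<open>q x + q y \<le> q (x \<oplus> y)\<close>. The same construction applied
  to the norm, with \<open>y = x0\<close>, makes the value at \<open>\<ominus> x0\<close> at most \<open>- nrm E x0\<close>, so that every
  additive functional below it is nonzero at \<open>x0\<close>.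
\<close>

section \<open>Scalars\<close>

lemma scalar_field_simps [simp]:
  "carrier scalar_field = UNIV" "mult scalar_field = (*)" "one scalar_field = 1"
  "zero scalar_field = 0" "add scalar_field = (+)"
  by (simp_all add: scalar_field_def)

context normed_vspace
begin

lemma scale_closed: "x \<in> carrier E \<Longrightarrow> a \<odot> x \<in> carrier E"
  by simp

lemma scale_left_add: "x \<in> carrier E \<Longrightarrow> (a + b) \<odot> x = a \<odot> x \<oplus> b \<odot> x"
  using smult_l_distr[of a b x] by simp

lemma scale_right_add:
  "\<lbrakk>x \<in> carrier E; y \<in> carrier E\<rbrakk> \<Longrightarrow> a \<odot> (x \<oplus> y) = a \<odot> x \<oplus> a \<odot> y"
  using smult_r_distr[of a x y] by simp

lemma scale_scale: "x \<in> carrier E \<Longrightarrow> a \<odot> (b \<odot> x) = (a * b) \<odot> x"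
  using smult_assoc1[of a b x] by simp

lemma scale_one: "x \<in> carrier E \<Longrightarrow> 1 \<odot> x = x"
  using smult_one[of x] by simp

lemma scale_zero_left: "x \<in> carrier E \<Longrightarrow> 0 \<odot> x = \<zero>"
  using smult_l_null[of x] by simp

lemma scale_zero_right: "a \<odot> \<zero> = \<zero>"
  using smult_r_null[of a] by simp

lemma uminus_eq_scale: "x \<in> carrier E \<Longrightarrow> \<ominus> x = (- 1) \<odot> x"
  using scale_left_add[of x "-1" 1] M.minus_equality[of "(-1) \<odot> x" x]
  by (simp add: scale_one scale_zero_left scale_closed)

lemma nrm_zero: "nrm E \<zero> = 0"
  by (simp add: nrm_eq_0_iff)

end

section \<open>Operators are the bounded linear maps\<close>

lemma operatorsD:
  assumes "T \<in> operators E F"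
  shows "T \<in> carrier E \<rightarrow>\<^sub>E carrier F"
    and "x \<in> carrier E \<Longrightarrow> T x \<in> carrier F"
    and "\<lbrakk>x \<in> carrier E; y \<in> carrier E\<rbrakk> \<Longrightarrow> T (x \<oplus>\<^bsub>E\<^esub> y) = T x \<oplus>\<^bsub>F\<^esub> T y"
    and "x \<in> carrier E \<Longrightarrow> T (a \<odot>\<^bsub>E\<^esub> x) = a \<odot>\<^bsub>F\<^esub> T x"
  using assms by (auto simp: operators_def)

text \<open>
  Continuity at zero bounds the image of a ball of some radius \<open>\<delta>\<close> by 1. A nonzero \<open>x\<close> is scaled to
  norm \<open>\<delta> / 2\<close>, strictly inside that ball, which is where the constant \<open>2 / \<delta>\<close> comes from.
\<close>

lemma operators_bounded:
  fixes E :: "('k::real_normed_field, 'a) normed_space" and F :: "('k, 'b) normed_space"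
  assumes "normed_vspace E" "normed_vspace F" "T \<in> operators E F"
  obtains C where "C > 0" "\<And>x. x \<in> carrier E \<Longrightarrow> nrm F (T x) \<le> C * nrm E x"
proof -
  interpret E: normed_vspace E by fact
  interpret F: normed_vspace F by fact
  interpret ME: Metric_space "carrier E" "ndist E" by (rule E.Metric_space_ndist)
  interpret MF: Metric_space "carrier F" "ndist F" by (rule F.Metric_space_ndist)
  note T = operatorsD[OF assms(3)]
  have T0: "T \<zero>\<^bsub>E\<^esub> = \<zero>\<^bsub>F\<^esub>"
    using T(4)[of "\<zero>\<^bsub>E\<^esub>" 0] T(2)[of "\<zero>\<^bsub>E\<^esub>"] by (simp add: E.scale_zero_right F.scale_zero_left)
  have cont: "continuous_map ME.mtopology MF.mtopology T"
    using assms(3) by (simp add: operators_def)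
  have "\<forall>a\<in>carrier E. \<forall>\<epsilon>>0. \<exists>\<delta>>0. \<forall>x. x \<in> carrier E \<and> ndist E a x < \<delta> \<longrightarrow> ndist F (T a) (T x) < \<epsilon>"
    using cont MF.Metric_space_axioms by (auto simp: ME.metric_continuous_map)
  then obtain \<delta> where \<delta>: "\<delta> > 0"
    and less: "\<And>x. \<lbrakk>x \<in> carrier E; ndist E \<zero>\<^bsub>E\<^esub> x < \<delta>\<rbrakk> \<Longrightarrow> ndist F (T \<zero>\<^bsub>E\<^esub>) (T x) < 1"
    using E.M.zero_closed zero_less_one by metis
  have small: "nrm F (T x) < 1" if x: "x \<in> carrier E" "nrm E x < \<delta>" for x
    using less[OF x(1)] x T(2)[OF x(1)]
    by (simp add: T0 ndist_def a_minus_def E.nrm_uminus F.nrm_uminus)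
  have "nrm F (T x) \<le> (2 / \<delta>) * nrm E x" if x: "x \<in> carrier E" for x
  proof (cases "nrm E x = 0")
    case True
    then show ?thesis
      using x T0 by (simp add: E.nrm_eq_0_iff E.nrm_zero F.nrm_zero)
  next
    case False
    then have pos: "nrm E x > 0"
      using E.nrm_nonneg[OF x] by simp
    define c where "c = \<delta> / (2 * nrm E x)"
    have c: "c > 0" "c * nrm E x < \<delta>"
      using pos \<delta> by (simp_all add: c_def)
    have "nrm F (T (of_real c \<odot>\<^bsub>E\<^esub> x)) < 1"
      using c x by (intro small) (simp_all add: E.nrm_smult)
    then have "c * nrm F (T x) < 1"
      using c x T by (simp add: F.nrm_smult)
    then show ?thesis
      using pos \<delta> by (simp add: c_def field_simps)
  qed
  then show thesis
    using that[of "2 / \<delta>"] \<delta> by simp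
qed

lemma operatorsI:
  fixes E :: "('k::real_normed_field, 'a) normed_space" and F :: "('k, 'b) normed_space"
  assumes "normed_vspace E" "normed_vspace F"
    and fn: "T \<in> carrier E \<rightarrow>\<^sub>E carrier F"
    and add: "\<And>x y. \<lbrakk>x \<in> carrier E; y \<in> carrier E\<rbrakk> \<Longrightarrow> T (x \<oplus>\<^bsub>E\<^esub> y) = T x \<oplus>\<^bsub>F\<^esub> T y"
    and scale: "\<And>a x. x \<in> carrier E \<Longrightarrow> T (a \<odot>\<^bsub>E\<^esub> x) = a \<odot>\<^bsub>F\<^esub> T x"
    and bound: "\<And>x. x \<in> carrier E \<Longrightarrow> nrm F (T x) \<le> C * nrm E x"
  shows "T \<in> operators E F"
proof -
  interpret E: normed_vspace E by fact
  interpret F: normed_vspace F by fact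
  interpret ME: Metric_space "carrier E" "ndist E" by (rule E.Metric_space_ndist)
  interpret MF: Metric_space "carrier F" "ndist F" by (rule F.Metric_space_ndist)
  have Tc: "T x \<in> carrier F" if "x \<in> carrier E" for x
    using fn that by auto
  have dist: "ndist F (T a) (T x) \<le> (\<bar>C\<bar> + 1) * ndist E a x" if ax: "a \<in> carrier E" "x \<in> carrier E" for a x
  proof -
    have "T a \<ominus>\<^bsub>F\<^esub> T x = T (a \<ominus>\<^bsub>E\<^esub> x)"
      using ax Tc by (simp add: a_minus_def E.uminus_eq_scale F.uminus_eq_scale add scale E.scale_closed)
    then have "nrm F (T a \<ominus>\<^bsub>F\<^esub> T x) \<le> C * nrm E (a \<ominus>\<^bsub>E\<^esub> x)"
      using bound ax by simp
    also have "\<dots> \<le> (\<bar>C\<bar> + 1) * nrm E (a \<ominus>\<^bsub>E\<^esub> x)"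
      using ax by (intro mult_right_mono E.nrm_nonneg) auto
    finally show ?thesis
      using ax Tc by (simp add: ndist_def)
  qed
  have "continuous_map ME.mtopology MF.mtopology T"
    unfolding ME.metric_continuous_map[OF MF.Metric_space_axioms]
  proof (intro conjI ballI allI impI)
    show "T ` carrier E \<subseteq> carrier F" using Tc by auto
    fix a and \<epsilon> :: real assume a: "a \<in> carrier E" and \<epsilon>: "\<epsilon> > 0"
    have "ndist F (T a) (T x) < \<epsilon>" if "x \<in> carrier E \<and> ndist E a x < \<epsilon> / (\<bar>C\<bar> + 1)" for x
    proof -
      have "(\<bar>C\<bar> + 1) * ndist E a x < \<epsilon>"
        using that by (simp add: field_simps)
      then show ?thesis
        using dist[OF a, of x] that by linarith
    qed
    then show "\<exists>\<delta>>0. \<forall>x. x \<in> carrier E \<and> ndist E a x < \<delta> \<longrightarrow> ndist F (T a) (T x) < \<epsilon>"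
      using \<epsilon> by (intro exI[of _ "\<epsilon> / (\<bar>C\<bar> + 1)"]) auto
  qed
  then show ?thesis
    using fn add scale by (simp add: operators_def)
qed

lemma compose_in_operators:
  fixes E :: "('k::real_normed_field, 'a) normed_space" and F :: "('k, 'b) normed_space"
    and G :: "('k, 'c) normed_space"
  assumes E: "normed_vspace E" and F: "normed_vspace F" and G: "normed_vspace G"
    and T: "T \<in> operators F G" and S: "S \<in> operators E F"
  shows "compose (carrier E) T S \<in> operators E G"
proof -
  interpret E: normed_vspace E by fact
  obtain C where C: "C > 0" "\<And>x. x \<in> carrier F \<Longrightarrow> nrm G (T x) \<le> C * nrm F x"
    using operators_bounded[OF F G T] by blast
  obtain D where D: "D > 0" "\<And>x. x \<in> carrier E \<Longrightarrow> nrm F (S x) \<le> D * nrm E x"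
    using operators_bounded[OF E F S] by blast
  show ?thesis
  proof (rule operatorsI[OF E G])
    show "compose (carrier E) T S \<in> carrier E \<rightarrow>\<^sub>E carrier G"
      using operatorsD[OF T] operatorsD[OF S] by (auto simp: compose_def)
    fix x assume x: "x \<in> carrier E"
    have "C * nrm F (S x) \<le> C * (D * nrm E x)"
      using C D x by simp
    then show "nrm G (compose (carrier E) T S x) \<le> (C * D) * nrm E x"
      using C(2)[of "S x"] x operatorsD(2)[OF S x] by (simp add: compose_def mult.assoc)
  qed (simp_all add: compose_def operatorsD[OF T] operatorsD[OF S])
qed

lemma operator_space_simps [simp]:
  "carrier (operator_space E F) = operators E F"
  "zero (operator_space E F) = (\<lambda>x\<in>carrier E. \<zero>\<^bsub>F\<^esub>)"
  "add (operator_space E F) = (\<lambda>S T. \<lambda>x\<in>carrier E. S x \<oplus>\<^bsub>F\<^esub> T x)"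
  "smult (operator_space E F) = (\<lambda>a T. \<lambda>x\<in>carrier E. a \<odot>\<^bsub>F\<^esub> T x)"
  by (simp_all add: operator_space_def)

lemma zero_in_operators:
  fixes E :: "('k::real_normed_field, 'a) normed_space" and F :: "('k, 'b) normed_space"
  assumes E: "normed_vspace E" and F: "normed_vspace F"
  shows "(\<lambda>x\<in>carrier E. \<zero>\<^bsub>F\<^esub>) \<in> operators E F"
proof -
  interpret E: normed_vspace E by fact
  interpret F: normed_vspace F by fact
  show ?thesis
    by (rule operatorsI[OF E F, where C = 0]) (auto simp: F.scale_zero_right F.nrm_zero)
qed

lemma add_in_operators:
  fixes E :: "('k::real_normed_field, 'a) normed_space" and F :: "('k, 'b) normed_space"
  assumes E: "normed_vspace E" and F: "normed_vspace F"
    and S: "S \<in> operators E F" and T: "T \<in> operators E F"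
  shows "(\<lambda>x\<in>carrier E. S x \<oplus>\<^bsub>F\<^esub> T x) \<in> operators E F"
proof -
  interpret E: normed_vspace E by fact
  interpret F: normed_vspace F by fact
  obtain C where C: "\<And>x. x \<in> carrier E \<Longrightarrow> nrm F (S x) \<le> C * nrm E x"
    using operators_bounded[OF E F S] by blast
  obtain D where D: "\<And>x. x \<in> carrier E \<Longrightarrow> nrm F (T x) \<le> D * nrm E x"
    using operators_bounded[OF E F T] by blast
  show ?thesis
  proof (rule operatorsI[OF E F])
    fix x assume x: "x \<in> carrier E"
    then have "nrm F (S x \<oplus>\<^bsub>F\<^esub> T x) \<le> nrm F (S x) + nrm F (T x)"
      by (simp add: F.nrm_triangle operatorsD[OF S] operatorsD[OF T])
    then show "nrm F ((\<lambda>x\<in>carrier E. S x \<oplus>\<^bsub>F\<^esub> T x) x) \<le> (C + D) * nrm E x"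
      using C[OF x] D[OF x] x by (simp add: ring_distribs)
  qed (auto simp: operatorsD[OF S] operatorsD[OF T] F.scale_right_add F.M.a_ac)
qed

lemma scale_in_operators:
  fixes E :: "('k::real_normed_field, 'a) normed_space" and F :: "('k, 'b) normed_space"
  assumes E: "normed_vspace E" and F: "normed_vspace F" and T: "T \<in> operators E F"
  shows "(\<lambda>x\<in>carrier E. a \<odot>\<^bsub>F\<^esub> T x) \<in> operators E F"
proof -
  interpret E: normed_vspace E by fact
  interpret F: normed_vspace F by fact
  obtain C where C: "\<And>x. x \<in> carrier E \<Longrightarrow> nrm F (T x) \<le> C * nrm E x"
    using operators_bounded[OF E F T] by blast
  show ?thesis
  proof (rule operatorsI[OF E F])
    fix x assume x: "x \<in> carrier E"
    then show "nrm F ((\<lambda>x\<in>carrier E. a \<odot>\<^bsub>F\<^esub> T x) x) \<le> (norm a * C) * nrm E x"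
      using mult_left_mono[OF C[OF x], of "norm a"]
      by (simp add: F.nrm_smult operatorsD[OF T] mult.assoc)
  qed (auto simp: operatorsD[OF T] F.scale_right_add F.scale_scale mult.commute F.scale_closed)
qed

lemma operator_space_module:
  fixes E :: "('k::real_normed_field, 'a) normed_space" and F :: "('k, 'b) normed_space"
  assumes E: "normed_vspace E" and F: "normed_vspace F"
  shows "Module.module scalar_field (operator_space E F)"
proof -
  interpret E: normed_vspace E by fact
  interpret F: normed_vspace F by fact
  have op_eq: "S = T" if "S \<in> operators E F" "T \<in> operators E F" "\<And>x. x \<in> carrier E \<Longrightarrow> S x = T x" for S T
    using that operatorsD(1) by (metis PiE_ext)
  show ?thesis
  proof (rule moduleI)
    show "cring (scalar_field :: 'k ring)"
      by (rule E.R.is_cring)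
    show "abelian_group (operator_space E F)"
    proof (rule abelian_groupI, unfold operator_space_simps)
      fix T assume T: "T \<in> operators E F"
      show "\<exists>S\<in>operators E F. (\<lambda>x\<in>carrier E. S x \<oplus>\<^bsub>F\<^esub> T x) = (\<lambda>x\<in>carrier E. \<zero>\<^bsub>F\<^esub>)"
      proof (rule bexI[of _ "\<lambda>x\<in>carrier E. (- 1) \<odot>\<^bsub>F\<^esub> T x"])
        show "(\<lambda>x\<in>carrier E. (\<lambda>x\<in>carrier E. (- 1) \<odot>\<^bsub>F\<^esub> T x) x \<oplus>\<^bsub>F\<^esub> T x) = (\<lambda>x\<in>carrier E. \<zero>\<^bsub>F\<^esub>)"
          by (rule restrict_ext)
            (simp add: operatorsD[OF T] F.M.l_neg flip: F.uminus_eq_scale)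
      qed (rule scale_in_operators[OF E F T])
      show "(\<lambda>x\<in>carrier E. (\<lambda>x\<in>carrier E. \<zero>\<^bsub>F\<^esub>) x \<oplus>\<^bsub>F\<^esub> T x) = T"
        by (rule op_eq[OF add_in_operators[OF E F zero_in_operators[OF E F] T] T])
          (simp add: operatorsD[OF T])
    qed (auto simp: add_in_operators[OF E F] zero_in_operators[OF E F] operatorsD F.M.a_ac
        intro!: restrict_ext)
  next
    fix T assume "T \<in> carrier (operator_space E F)"
    then have T: "T \<in> operators E F" by simp
    show "\<one>\<^bsub>scalar_field\<^esub> \<odot>\<^bsub>operator_space E F\<^esub> T = T"
      using T by (auto intro!: op_eq scale_in_operators[OF E F] simp: F.scale_one operatorsD[OF T])
  qed (auto simp: scale_in_operators[OF E F] operatorsD F.scale_left_add F.scale_right_add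
      F.scale_scale intro!: restrict_ext)
qed

section \<open>Nonzero bounded functionals\<close>

definition sublinear :: "('k::real_normed_field, 'a) normed_space \<Rightarrow> ('a \<Rightarrow> real) \<Rightarrow> bool" where
  "sublinear E q \<longleftrightarrow>
     (\<forall>x\<in>carrier E. \<forall>y\<in>carrier E. q (x \<oplus>\<^bsub>E\<^esub> y) \<le> q x + q y) \<and>
     (\<forall>t\<ge>0. \<forall>x\<in>carrier E. q (of_real t \<odot>\<^bsub>E\<^esub> x) \<le> t * q x)"

lemma sublinearD:
  assumes "sublinear E q" "x \<in> carrier E"
  shows "y \<in> carrier E \<Longrightarrow> q (x \<oplus>\<^bsub>E\<^esub> y) \<le> q x + q y"
    and "t \<ge> 0 \<Longrightarrow> q (of_real t \<odot>\<^bsub>E\<^esub> x) \<le> t * q x"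
  using assms by (auto simp: sublinear_def)

lemma sublinear_cong:
  assumes "normed_vspace E" "\<And>x. x \<in> carrier E \<Longrightarrow> p x = q x"
  shows "sublinear E p \<longleftrightarrow> sublinear E q"
proof -
  interpret E: normed_vspace E by fact
  show ?thesis by (simp add: sublinear_def assms(2))
qed

context normed_vspace
begin

lemma sublinear_zero:
  assumes "sublinear E q"
  shows "q \<zero> = 0"
  using sublinearD(1)[OF assms, of \<zero> \<zero>] sublinearD(2)[OF assms, of \<zero> 0]
  by (simp add: scale_zero_left)

text \<open>Scaling back by \<open>1 / t\<close> turns the inequality in the definition into an equality.\<close>

lemma sublinear_homogeneous:
  assumes q: "sublinear E q" and x: "x \<in> carrier E" and t: "t \<ge> 0"
  shows "q (of_real t \<odot> x) = t * q x"
proof (cases "t = 0")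
  case True
  then show ?thesis using x by (simp add: scale_zero_left sublinear_zero[OF q])
next
  case False
  have "q (of_real (1 / t) \<odot> (of_real t \<odot> x)) \<le> (1 / t) * q (of_real t \<odot> x)"
    using sublinearD(2)[OF q, of "of_real t \<odot> x" "1 / t"] x t by (simp add: scale_closed)
  moreover have "of_real (1 / t) \<odot> (of_real t \<odot> x) = x"
    using x False by (simp add: scale_scale scale_one)
  ultimately have "t * q x \<le> q (of_real t \<odot> x)"
    using False t by (simp add: field_simps)
  then show ?thesis using sublinearD(2)[OF q x t] by simp
qed

lemma sublinear_neg:
  assumes q: "sublinear E q" and x: "x \<in> carrier E"
  shows "- q (\<ominus> x) \<le> q x"
  using sublinearD(1)[OF q x, of "\<ominus> x"] x by (simp add: M.r_neg sublinear_zero[OF q])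

lemma sublinear_nrm: "sublinear E (nrm E)"
  by (simp add: sublinear_def nrm_triangle nrm_smult)

text \<open>
  The functional \<open>q'\<close> constructed here is the largest sublinear functional below \<open>q\<close> whose value at
  \<open>\<ominus> y\<close> is at most \<open>- q y\<close>: any such \<open>r\<close> satisfies
  \<open>r x \<le> r (x \<oplus> t \<odot> y) + t * r (\<ominus> y) \<le> q (x \<oplus> t \<odot> y) - t * q y\<close> for all \<open>t \<ge> 0\<close>.
\<close>

lemma sublinear_directional:
  assumes q: "sublinear E q" and y: "y \<in> carrier E"
  obtains q' where "sublinear E q'" "\<And>x. x \<in> carrier E \<Longrightarrow> q' x \<le> q x"
    "\<And>x. x \<in> carrier E \<Longrightarrow> q' x \<le> q (x \<oplus> y) - q y"
proof -
  define h where "h x t = q (x \<oplus> of_real t \<odot> y) - t * q y" for x t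
  define q' where "q' x = (INF t\<in>{0..}. h x t)" for x
  have bdd: "bdd_below (h x ` {0..})" if x: "x \<in> carrier E" for x
  proof (rule bdd_belowI2)
    fix t :: real assume "t \<in> {0..}"
    then have t: "t \<ge> 0" by simp
    have "of_real t \<odot> y = (x \<oplus> of_real t \<odot> y) \<oplus> \<ominus> x"
      using x y by (simp add: M.a_ac scale_closed M.r_neg1 M.r_neg2 M.r_neg)
    then have "t * q y \<le> q (x \<oplus> of_real t \<odot> y) + q (\<ominus> x)"
      using sublinearD(1)[OF q, of "x \<oplus> of_real t \<odot> y" "\<ominus> x"] x y t
        sublinear_homogeneous[OF q y t] by (simp add: scale_closed)
    then show "- q (\<ominus> x) \<le> h x t" by (simp add: h_def)
  qed
  have lower: "q' x \<le> h x t" if "x \<in> carrier E" "t \<ge> 0" for x t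
    unfolding q'_def using that by (intro cINF_lower bdd) auto
  have greatest: "c \<le> q' x" if "\<And>t. t \<ge> 0 \<Longrightarrow> c \<le> h x t" for c x
    unfolding q'_def using that by (intro cINF_greatest) auto
  show thesis
  proof (rule that)
    show "sublinear E q'"
      unfolding sublinear_def
    proof (intro conjI ballI allI impI)
      fix x z assume x: "x \<in> carrier E" and z: "z \<in> carrier E"
      have hh: "q' (x \<oplus> z) \<le> h x s + h z t" if s: "s \<ge> 0" and t: "t \<ge> 0" for s t
      proof -
        have "(x \<oplus> z) \<oplus> of_real (s + t) \<odot> y = (x \<oplus> of_real s \<odot> y) \<oplus> (z \<oplus> of_real t \<odot> y)"
          using x y z by (simp add: scale_left_add M.a_ac scale_closed)
        then have "h (x \<oplus> z) (s + t) \<le> h x s + h z t"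
          using sublinearD(1)[OF q, of "x \<oplus> of_real s \<odot> y" "z \<oplus> of_real t \<odot> y"] x y z
          by (simp add: h_def scale_closed ring_distribs)
        then show ?thesis
          using lower[of "x \<oplus> z" "s + t"] x z s t by simp
      qed
      have "q' (x \<oplus> z) - h z t \<le> q' x" if t: "t \<ge> 0" for t
        by (rule greatest) (use hh[OF _ t] in \<open>simp add: algebra_simps\<close>)
      then have "q' (x \<oplus> z) - q' x \<le> q' z"
        by (intro greatest) (simp add: algebra_simps)
      then show "q' (x \<oplus> z) \<le> q' x + q' z" by simp
    next
      fix c :: real and x assume c: "c \<ge> 0" and x: "x \<in> carrier E"
      show "q' (of_real c \<odot> x) \<le> c * q' x"
      proof (cases "c = 0")
        case True
        then show ?thesis
          using lower[of \<zero> 0] x y by (simp add: scale_zero_left h_def sublinear_zero[OF q])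
      next
        case False
        have "q' (of_real c \<odot> x) / c \<le> h x t" if t: "t \<ge> 0" for t
        proof -
          have "of_real c \<odot> x \<oplus> of_real (c * t) \<odot> y = of_real c \<odot> (x \<oplus> of_real t \<odot> y)"
            using x y by (simp add: scale_right_add scale_scale scale_closed)
          then have "h (of_real c \<odot> x) (c * t) = c * h x t"
            using sublinear_homogeneous[OF q _ c, of "x \<oplus> of_real t \<odot> y"] x y
            by (simp add: h_def scale_closed ring_distribs)
          then show ?thesis
            using lower[of "of_real c \<odot> x" "c * t"] x c t False
            by (simp add: scale_closed field_simps)
        qed
        then have "q' (of_real c \<odot> x) / c \<le> q' x" by (rule greatest)
        then show ?thesis using c False by (simp add: field_simps)
      qed
    qed
    show "q' x \<le> q x" if "x \<in> carrier E" for x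
      using lower[of x 0] that y by (simp add: h_def scale_zero_left)
    show "q' x \<le> q (x \<oplus> y) - q y" if "x \<in> carrier E" for x
      using lower[of x 1] that y by (simp add: h_def scale_one)
  qed
qed

text \<open>
  A chain of sublinear functionals below \<open>p\<close> is bounded below at \<open>x\<close> by \<open>- p (\<ominus> x)\<close>, and its
  pointwise infimum is sublinear because two members of a chain have a common lower bound in it.
\<close>

lemma sublinear_chain_Inf:
  assumes "C \<noteq> {}" and sub: "\<And>q. q \<in> C \<Longrightarrow> sublinear E q"
    and below: "\<And>q x. \<lbrakk>q \<in> C; x \<in> carrier E\<rbrakk> \<Longrightarrow> q x \<le> p x"
    and chain: "\<And>q r. \<lbrakk>q \<in> C; r \<in> C\<rbrakk> \<Longrightarrow> (\<forall>x. q x \<le> r x) \<or> (\<forall>x. r x \<le> q x)"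
  shows "sublinear E (\<lambda>x. INF q\<in>C. q x)"
    and "\<And>q x. \<lbrakk>q \<in> C; x \<in> carrier E\<rbrakk> \<Longrightarrow> (INF q\<in>C. q x) \<le> q x"
proof -
  have bdd: "bdd_below ((\<lambda>q. q x) ` C)" if x: "x \<in> carrier E" for x
  proof (rule bdd_belowI2)
    fix q assume q: "q \<in> C"
    show "- p (\<ominus> x) \<le> q x"
      using sublinear_neg[OF sub[OF q] x] below[OF q, of "\<ominus> x"] x by simp
  qed
  show lower: "(INF q\<in>C. q x) \<le> q x" if "q \<in> C" "x \<in> carrier E" for q x
    using that by (intro cINF_lower bdd)
  have greatest: "c \<le> (INF q\<in>C. q x)" if "\<And>q. q \<in> C \<Longrightarrow> c \<le> q x" for c x
    using that \<open>C \<noteq> {}\<close> by (intro cINF_greatest)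
  show "sublinear E (\<lambda>x. INF q\<in>C. q x)"
    unfolding sublinear_def
  proof (intro conjI ballI allI impI)
    fix x z assume x: "x \<in> carrier E" and z: "z \<in> carrier E"
    have qr: "(INF q\<in>C. q (x \<oplus> z)) \<le> q x + r z" if q: "q \<in> C" and r: "r \<in> C" for q r
    proof -
      obtain s where s: "s \<in> C" "s x \<le> q x" "s z \<le> r z"
        using chain[OF q r] q r by blast
      have "(INF q\<in>C. q (x \<oplus> z)) \<le> s (x \<oplus> z)" using lower s x z by simp
      then show ?thesis using sublinearD(1)[OF sub[OF s(1)] x z] s by simp
    qed
    have "(INF q\<in>C. q (x \<oplus> z)) - r z \<le> (INF q\<in>C. q x)" if r: "r \<in> C" for r
      by (rule greatest) (use qr[OF _ r] in \<open>simp add: algebra_simps\<close>)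
    then have "(INF q\<in>C. q (x \<oplus> z)) - (INF q\<in>C. q x) \<le> (INF q\<in>C. q z)"
      by (intro greatest) (simp add: algebra_simps)
    then show "(INF q\<in>C. q (x \<oplus> z)) \<le> (INF q\<in>C. q x) + (INF q\<in>C. q z)" by simp
  next
    fix c :: real and x assume c: "c \<ge> 0" and x: "x \<in> carrier E"
    show "(INF q\<in>C. q (of_real c \<odot> x)) \<le> c * (INF q\<in>C. q x)"
    proof (cases "c = 0")
      case True
      obtain q where "q \<in> C" using \<open>C \<noteq> {}\<close> by blast
      then show ?thesis
        using lower[of q \<zero>] x True by (simp add: scale_zero_left sublinear_zero[OF sub])
    next
      case False
      have "(INF q\<in>C. q (of_real c \<odot> x)) / c \<le> q x" if q: "q \<in> C" for q
        using lower[OF q, of "of_real c \<odot> x"] sublinearD(2)[OF sub[OF q] x c] c False x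
        by (simp add: scale_closed field_simps)
      then have "(INF q\<in>C. q (of_real c \<odot> x)) / c \<le> (INF q\<in>C. q x)" by (rule greatest)
      then show ?thesis using c False by (simp add: field_simps)
    qed
  qed
qed

text \<open>
  Zorn's lemma provides a minimal sublinear functional \<open>m\<close> below \<open>p\<close>, and \<open>m\<close> is additive because it
  agrees with the functional that \<open>sublinear_directional\<close> yields from it for any direction.
\<close>

lemma additive_minorant:
  assumes p: "sublinear E p"
  obtains f where "sublinear E f" "\<And>x. x \<in> carrier E \<Longrightarrow> f x \<le> p x"
    "\<And>x y. \<lbrakk>x \<in> carrier E; y \<in> carrier E\<rbrakk> \<Longrightarrow> f (x \<oplus> y) = f x + f y"
proof -
  have V: "normed_vspace E" by unfold_locales
  define A where "A = {q. sublinear E q \<and> (\<forall>x\<in>carrier E. q x \<le> p x) \<and> (\<forall>x. x \<notin> carrier E \<longrightarrow> q x = 0)}"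
  \<comment> \<open>The value 0 off the carrier makes the pointwise order on \<open>A\<close> antisymmetric.\<close>
  define cut where "cut q x = (if x \<in> carrier E then q x else (0::real))" for q x
  have cutA: "cut q \<in> A" if "sublinear E q" "\<And>x. x \<in> carrier E \<Longrightarrow> q x \<le> p x" for q
    using that sublinear_cong[OF V, of "cut q" q] by (simp add: A_def cut_def)
  have "\<exists>m\<in>A. \<forall>a\<in>A. (\<forall>x. a x \<le> m x) \<longrightarrow> a = m"
  proof (rule predicate_Zorn)
    show "partial_order_on A (relation_of (\<lambda>a b. \<forall>x. b x \<le> a x) A)"
      by (rule partial_order_on_relation_ofI) (auto simp: fun_eq_iff intro: order_trans order_antisym)
    fix C assume C: "C \<in> Chains (relation_of (\<lambda>a b. \<forall>x. b x \<le> a x) A)"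
    then have CA: "C \<subseteq> A"
      by (auto simp: Chains_def relation_of_def)
    show "\<exists>u\<in>A. \<forall>a\<in>C. \<forall>x. u x \<le> a x"
    proof (cases "C = {}")
      case True
      then show ?thesis using cutA[OF p] by auto
    next
      case False
      have sub: "sublinear E q" if "q \<in> C" for q
        using that CA by (auto simp: A_def)
      have below: "q x \<le> p x" if "q \<in> C" "x \<in> carrier E" for q x
        using that CA by (auto simp: A_def)
      have chain: "(\<forall>x. q x \<le> r x) \<or> (\<forall>x. r x \<le> q x)" if "q \<in> C" "r \<in> C" for q r
        using that C by (auto simp: Chains_def relation_of_def)
      have I1: "sublinear E (\<lambda>x. INF q\<in>C. q x)"
        by (rule sublinear_chain_Inf(1)[where C = C and p = p]) (fact False sub below chain)+
      have I2: "(INF q\<in>C. q x) \<le> q x" if "q \<in> C" "x \<in> carrier E" for q x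
        by (rule sublinear_chain_Inf(2)[where C = C and p = p]) (fact False sub below chain that)+
      have "(INF q\<in>C. q x) \<le> p x" if "x \<in> carrier E" for x
        using False I2 below that by (meson ex_in_conv order_trans)
      then have "cut (\<lambda>x. INF q\<in>C. q x) \<in> A" by (intro cutA I1)
      moreover have "cut (\<lambda>x. INF q\<in>C. q x) x \<le> a x" if "a \<in> C" for a x
        using I2 that CA by (auto simp: cut_def A_def)
      ultimately show ?thesis by blast
    qed
  qed
  then obtain m where m: "m \<in> A" and min: "\<And>a. \<lbrakk>a \<in> A; \<And>x. a x \<le> m x\<rbrakk> \<Longrightarrow> a = m"
    by blast
  have sm: "sublinear E m" and mp: "\<And>x. x \<in> carrier E \<Longrightarrow> m x \<le> p x"
    and m0: "\<And>x. x \<notin> carrier E \<Longrightarrow> m x = 0"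
    using m by (auto simp: A_def)
  have "m x + m y \<le> m (x \<oplus> y)" if x: "x \<in> carrier E" and y: "y \<in> carrier E" for x y
  proof -
    obtain q where q: "sublinear E q" "\<And>x. x \<in> carrier E \<Longrightarrow> q x \<le> m x"
      "\<And>x. x \<in> carrier E \<Longrightarrow> q x \<le> m (x \<oplus> y) - m y"
      using sublinear_directional[OF sm y] by blast
    have "cut q = m"
      using q mp by (intro min cutA) (auto simp: cut_def m0 intro: order_trans)
    then have "q x = m x" using x by (auto simp: cut_def)
    then show ?thesis using q(3)[OF x] by simp
  qed
  then show thesis
    using that[OF sm mp] sublinearD(1)[OF sm] by (meson order_antisym)
qed

text \<open>
  An additive functional below the norm need not be nonzero, so the norm is first replaced by a
  sublinear functional with value at most \<open>- nrm E x0\<close> at \<open>\<ominus> x0\<close>. Real homogeneity comes from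
  positive homogeneity and additivity, whatever the scalar field.
\<close>

lemma real_Hahn_Banach:
  assumes x0: "x0 \<in> carrier E"
  obtains f :: "'a \<Rightarrow> real" where
    "\<And>x y. \<lbrakk>x \<in> carrier E; y \<in> carrier E\<rbrakk> \<Longrightarrow> f (x \<oplus> y) = f x + f y"
    "\<And>t x. x \<in> carrier E \<Longrightarrow> f (of_real t \<odot> x) = t * f x"
    "\<And>x. x \<in> carrier E \<Longrightarrow> \<bar>f x\<bar> \<le> nrm E x"
    "f x0 = nrm E x0"
proof -
  obtain p where p: "sublinear E p" "\<And>x. x \<in> carrier E \<Longrightarrow> p x \<le> nrm E x"
    "\<And>x. x \<in> carrier E \<Longrightarrow> p x \<le> nrm E (x \<oplus> x0) - nrm E x0"
    using sublinear_directional[OF sublinear_nrm x0] by blast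
  obtain f where f: "sublinear E f" "\<And>x. x \<in> carrier E \<Longrightarrow> f x \<le> p x"
    and add: "\<And>x y. \<lbrakk>x \<in> carrier E; y \<in> carrier E\<rbrakk> \<Longrightarrow> f (x \<oplus> y) = f x + f y"
    using additive_minorant[OF p(1)] by blast
  have neg: "f (\<ominus> x) = - f x" if x: "x \<in> carrier E" for x
    using add[OF x, of "\<ominus> x"] x by (simp add: M.r_neg sublinear_zero[OF f(1)])
  have le: "f x \<le> nrm E x" if "x \<in> carrier E" for x
    using f(2) p(2) that by (meson order_trans)
  have bound: "\<bar>f x\<bar> \<le> nrm E x" if x: "x \<in> carrier E" for x
    using le[OF x] le[of "\<ominus> x"] x by (simp add: neg nrm_uminus abs_le_iff)
  have scale: "f (of_real t \<odot> x) = t * f x" if x: "x \<in> carrier E" for t x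
  proof (cases "t \<ge> 0")
    case True
    then show ?thesis by (rule sublinear_homogeneous[OF f(1) x])
  next
    case False
    then have "f (of_real (- t) \<odot> (\<ominus> x)) = - t * f (\<ominus> x)"
      using x by (intro sublinear_homogeneous[OF f(1)]) auto
    moreover have "of_real (- t) \<odot> (\<ominus> x) = of_real t \<odot> x"
      using x by (simp add: uminus_eq_scale scale_scale)
    ultimately show ?thesis using x by (simp add: neg)
  qed
  have "f (\<ominus> x0) \<le> - nrm E x0"
    using f(2)[of "\<ominus> x0"] p(3)[of "\<ominus> x0"] x0 by (simp add: M.l_neg nrm_zero)
  then have "f x0 = nrm E x0"
    using neg[OF x0] le[OF x0] by simp
  with add scale bound show thesis by (rule that)
qed

end

definition bounded_functional ::
  "('k::real_normed_field, 'a) normed_space \<Rightarrow> ('a \<Rightarrow> 'k) \<Rightarrow> bool" where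
  "bounded_functional E g \<longleftrightarrow>
     (\<forall>x\<in>carrier E. \<forall>y\<in>carrier E. g (x \<oplus>\<^bsub>E\<^esub> y) = g x + g y) \<and>
     (\<forall>a. \<forall>x\<in>carrier E. g (a \<odot>\<^bsub>E\<^esub> x) = a * g x) \<and>
     (\<exists>C. \<forall>x\<in>carrier E. norm (g x) \<le> C * nrm E x)"

lemma bounded_functional_real:
  fixes E :: "(real, 'a) normed_space"
  assumes "normed_vspace E" and x0: "x0 \<in> carrier E" "x0 \<noteq> \<zero>\<^bsub>E\<^esub>"
  shows "\<exists>g. bounded_functional E g \<and> g x0 \<noteq> 0"
proof -
  interpret E: normed_vspace E by fact
  obtain f where f: "\<And>x y. \<lbrakk>x \<in> carrier E; y \<in> carrier E\<rbrakk> \<Longrightarrow> f (x \<oplus>\<^bsub>E\<^esub> y) = f x + f y"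
    "\<And>t x. x \<in> carrier E \<Longrightarrow> f (of_real t \<odot>\<^bsub>E\<^esub> x) = t * f x"
    "\<And>x. x \<in> carrier E \<Longrightarrow> \<bar>f x\<bar> \<le> nrm E x" "f x0 = nrm E x0"
    using E.real_Hahn_Banach[OF x0(1)] by blast
  have "bounded_functional E f"
    using f by (auto simp: bounded_functional_def intro: exI[of _ 1])
  moreover have "f x0 \<noteq> 0"
    using x0 f(4) by (simp add: E.nrm_eq_0_iff)
  ultimately show ?thesis by blast
qed

text \<open>
  A real-linear \<open>f\<close> is the real part of the complex-linear functional \<open>x \<mapsto> f x - \<i> * f (\<i> \<odot> x)\<close>.
\<close>

lemma bounded_functional_complex:
  fixes E :: "(complex, 'a) normed_space"
  assumes "normed_vspace E" and x0: "x0 \<in> carrier E" "x0 \<noteq> \<zero>\<^bsub>E\<^esub>"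
  shows "\<exists>g. bounded_functional E g \<and> g x0 \<noteq> 0"
proof -
  interpret E: normed_vspace E by fact
  obtain f where add: "\<And>x y. \<lbrakk>x \<in> carrier E; y \<in> carrier E\<rbrakk> \<Longrightarrow> f (x \<oplus>\<^bsub>E\<^esub> y) = f x + f y"
    and scale: "\<And>t x. x \<in> carrier E \<Longrightarrow> f (of_real t \<odot>\<^bsub>E\<^esub> x) = t * f x"
    and bound: "\<And>x. x \<in> carrier E \<Longrightarrow> \<bar>f x\<bar> \<le> nrm E x" and x0': "f x0 = nrm E x0"
    using E.real_Hahn_Banach[OF x0(1)] by blast
  define g where "g x = Complex (f x) (- f (\<i> \<odot>\<^bsub>E\<^esub> x))" for x
  have f_scale: "f (a \<odot>\<^bsub>E\<^esub> x) = Re a * f x + Im a * f (\<i> \<odot>\<^bsub>E\<^esub> x)" if x: "x \<in> carrier E" for a x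
  proof -
    have "a \<odot>\<^bsub>E\<^esub> x = (of_real (Re a) + of_real (Im a) * \<i>) \<odot>\<^bsub>E\<^esub> x"
      by (rule arg_cong[where f = "\<lambda>c. c \<odot>\<^bsub>E\<^esub> x"]) (simp add: complex_eq_iff)
    also have "\<dots> = of_real (Re a) \<odot>\<^bsub>E\<^esub> x \<oplus>\<^bsub>E\<^esub> of_real (Im a) \<odot>\<^bsub>E\<^esub> (\<i> \<odot>\<^bsub>E\<^esub> x)"
      using x by (simp only: E.scale_left_add E.scale_scale)
    finally show ?thesis
      using x by (simp add: add scale E.scale_closed)
  qed
  have "bounded_functional E g"
    unfolding bounded_functional_def
  proof (intro conjI ballI allI exI)
    fix x y assume "x \<in> carrier E" "y \<in> carrier E"
    then show "g (x \<oplus>\<^bsub>E\<^esub> y) = g x + g y"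
      by (simp add: g_def add E.scale_right_add E.scale_closed complex_eq_iff)
  next
    fix a x assume x: "x \<in> carrier E"
    show "g (a \<odot>\<^bsub>E\<^esub> x) = a * g x"
      using x f_scale[OF x, of a] f_scale[OF x, of "\<i> * a"]
      by (simp add: g_def E.scale_scale complex_eq_iff)
  next
    fix x assume x: "x \<in> carrier E"
    have "norm (g x) \<le> \<bar>Re (g x)\<bar> + \<bar>Im (g x)\<bar>" by (rule cmod_le)
    also have "\<dots> \<le> 2 * nrm E x"
      using bound[OF x] bound[of "\<i> \<odot>\<^bsub>E\<^esub> x"] x by (simp add: g_def E.nrm_smult E.scale_closed)
    finally show "norm (g x) \<le> 2 * nrm E x" .
  qed
  moreover have "g x0 \<noteq> 0"
    using x0 x0' by (simp add: g_def complex_eq_iff E.nrm_eq_0_iff)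
  ultimately show ?thesis by blast
qed

section \<open>Bounded sequences\<close>

lemma operator_image_nbounded:
  fixes E :: "('k::real_normed_field, 'a) normed_space" and F :: "('k, 'b) normed_space"
  assumes E: "normed_vspace E" and F: "normed_vspace F" and T: "T \<in> operators E F"
    and M: "nbounded E M"
  shows "nbounded F (T ` M)"
proof -
  interpret E: normed_vspace E by fact
  obtain C where C: "C > 0" "\<And>x. x \<in> carrier E \<Longrightarrow> nrm F (T x) \<le> C * nrm E x"
    using operators_bounded[OF E F T] by blast
  obtain D where D: "M \<subseteq> carrier E" "\<And>x. x \<in> M \<Longrightarrow> nrm E x \<le> D"
    using M by (auto simp: nbounded_def)
  have "nrm F (T x) \<le> C * D" if "x \<in> M" for x
  proof -
    have "nrm F (T x) \<le> C * nrm E x" using D(1) that by (intro C(2)) auto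
    also have "\<dots> \<le> C * D" using C(1) D(2)[OF that] by simp
    finally show ?thesis .
  qed
  then show ?thesis
    using D(1) operatorsD(2)[OF T] by (auto simp: nbounded_def)
qed

lemma circle_hull_nbounded:
  assumes E: "normed_vspace E" and M: "nbounded E M"
  shows "nbounded E (circle_hull E M)"
proof -
  interpret E: normed_vspace E by fact
  obtain C where C: "M \<subseteq> carrier E" "\<And>x. x \<in> M \<Longrightarrow> nrm E x \<le> C"
    using M by (auto simp: nbounded_def)
  have "nrm E (a \<odot>\<^bsub>E\<^esub> x) \<le> C" if "x \<in> M" "norm a \<le> 1" for a x
  proof -
    have "norm a * nrm E x \<le> 1 * nrm E x"
      using that C by (intro mult_right_mono E.nrm_nonneg) auto
    then show ?thesis
      using C that E.nrm_smult[of x a] by fastforce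
  qed
  then show ?thesis
    using C(1) by (auto simp: nbounded_def circle_hull_def E.scale_closed subset_eq)
qed

lemma ops_of_seqs_iff:
  "T \<in> ops_of_seqs \<Phi> E F \<longleftrightarrow> T \<in> operators E F \<and>
     (\<forall>x :: nat \<Rightarrow> 'a. nbounded E (range x) \<longrightarrow> (\<exists>r. strict_mono r \<and> (\<lambda>n. T (x (r n))) \<in> \<Phi> F))"
  by (simp add: ops_of_seqs_def seq_operators_def all_bounded_seqs_def comp_def)

lemma nbounded_subset: "\<lbrakk>nbounded E M; N \<subseteq> M\<rbrakk> \<Longrightarrow> nbounded E N"
  by (auto simp: nbounded_def)

lemma rank_one_in_operators:
  fixes E :: "('k::real_normed_field, 'a) normed_space" and F :: "('k, 'b) normed_space"
  assumes E: "normed_vspace E" and F: "normed_vspace F"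
    and g: "bounded_functional E g" and y: "y \<in> carrier F"
  shows "(\<lambda>x\<in>carrier E. g x \<odot>\<^bsub>F\<^esub> y) \<in> operators E F"
proof -
  interpret E: normed_vspace E by fact
  interpret F: normed_vspace F by fact
  obtain C where C: "\<And>x. x \<in> carrier E \<Longrightarrow> norm (g x) \<le> C * nrm E x"
    using g unfolding bounded_functional_def by blast
  have add: "g (x \<oplus>\<^bsub>E\<^esub> z) = g x + g z" if "x \<in> carrier E" "z \<in> carrier E" for x z
    using g that unfolding bounded_functional_def by blast
  have scale: "g (a \<odot>\<^bsub>E\<^esub> x) = a * g x" if "x \<in> carrier E" for a x
    using g that unfolding bounded_functional_def by blast
  show ?thesis
  proof (rule operatorsI[OF E F])
    fix x assume x: "x \<in> carrier E"
    have "nrm F (g x \<odot>\<^bsub>F\<^esub> y) = norm (g x) * nrm F y"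
      by (rule F.nrm_smult[OF y])
    also have "\<dots> \<le> C * nrm E x * nrm F y"
      by (rule mult_right_mono[OF C[OF x] F.nrm_nonneg[OF y]])
    finally show "nrm F ((\<lambda>x\<in>carrier E. g x \<odot>\<^bsub>F\<^esub> y) x) \<le> (C * nrm F y) * nrm E x"
      using x by (simp add: ac_simps)
  qed (simp_all add: y add scale F.scale_left_add F.scale_scale)
qed

lemma scale_in_lin_span:
  "y \<in> B \<Longrightarrow> a \<odot>\<^bsub>F\<^esub> y \<in> lin_span F B"
  using submodule.smult_closed[of _ scalar_field F a y] by (auto simp: lin_span_def)

section \<open>The ideal of a generating sequential structure\<close>

locale generating_structure =
  fixes \<Phi> :: "('k::real_normed_field, 'a) seq_family"
  assumes generating: "generating_sequential_structure \<Phi>"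
begin

lemma
  assumes "banach_space F"
  shows fin_dim_in: "fin_dim_bounded_seqs F \<subseteq> \<Phi> F"
    and bounded_in: "x \<in> \<Phi> F \<Longrightarrow> nbounded F (range x)"
    and combination_in: "\<lbrakk>x \<in> \<Phi> F; y \<in> \<Phi> F\<rbrakk> \<Longrightarrow> (\<lambda>n. a \<odot>\<^bsub>F\<^esub> x n \<oplus>\<^bsub>F\<^esub> b \<odot>\<^bsub>F\<^esub> y n) \<in> \<Phi> F"
    and subseq_in: "\<lbrakk>x \<in> \<Phi> F; strict_mono r\<rbrakk> \<Longrightarrow> (\<lambda>n. x (r n)) \<in> \<Phi> F"
  using generating assms
  by (auto simp: generating_sequential_structure_def vector_sequential_structure_def
      all_bounded_seqs_def comp_def)

lemma operator_subseq_in: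
  assumes "banach_space E" "banach_space F" "T \<in> operators E F" "x \<in> \<Phi> E"
  obtains r where "strict_mono r" "(\<lambda>n. T (x (r n))) \<in> \<Phi> F"
proof -
  have "T \<in> seq_operators E (\<Phi> E) F (\<Phi> F)"
    using generating assms(1-3) unfolding generating_sequential_structure_def by blast
  then show thesis
    using assms(4) that by (auto simp: seq_operators_def comp_def)
qed

lemma scale_in:
  assumes F: "banach_space F" and x: "x \<in> \<Phi> F"
  shows "(\<lambda>n. a \<odot>\<^bsub>F\<^esub> x n) \<in> \<Phi> F"
proof -
  interpret F: banach_space F by fact
  have "x n \<in> carrier F" for n
    using bounded_in[OF F x] by (auto simp: nbounded_def)
  then show ?thesis
    using combination_in[OF F x x, of a 0] by (simp add: F.scale_zero_left F.scale_closed)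
qed

text \<open>
  This is where \<open>\<Phi>\<close> has to contain the finite-dimensional bounded sequences: the image of any bounded
  sequence lies in the span of \<open>y\<close>, so the whole image sequence is in \<open>\<Phi> F\<close>.
\<close>

lemma rank_one_in_ops:
  assumes E: "banach_space E" and F: "banach_space F"
    and g: "bounded_functional E g" and y: "y \<in> carrier F"
  shows "(\<lambda>x\<in>carrier E. g x \<odot>\<^bsub>F\<^esub> y) \<in> ops_of_seqs \<Phi> E F"
proof -
  interpret E: banach_space E by fact
  interpret F: banach_space F by fact
  have VE: "normed_vspace E" and VF: "normed_vspace F" by unfold_locales
  let ?T = "\<lambda>x\<in>carrier E. g x \<odot>\<^bsub>F\<^esub> y"
  have T: "?T \<in> operators E F"
    by (rule rank_one_in_operators[OF VE VF g y])
  have "(\<lambda>n. ?T (x n)) \<in> \<Phi> F" if x: "nbounded E (range x)" for x :: "nat \<Rightarrow> 'a"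
  proof -
    have "nbounded F (range (\<lambda>n. ?T (x n)))"
      using operator_image_nbounded[OF VE VF T x] by (simp only: image_image)
    moreover have "fin_dim_subspace F (lin_span F {y})"
      using y by (auto simp: fin_dim_subspace_def)
    moreover have "range (\<lambda>n. ?T (x n)) \<subseteq> lin_span F {y}"
      using x by (auto simp: nbounded_def intro!: scale_in_lin_span)
    ultimately have "(\<lambda>n. ?T (x n)) \<in> fin_dim_bounded_seqs F"
      unfolding fin_dim_bounded_seqs_def all_bounded_seqs_def mem_Collect_eq
      by (intro conjI exI[of _ "lin_span F {y}"])
    then show ?thesis
      using fin_dim_in[OF F] by blast
  qed
  then have "\<exists>r. strict_mono r \<and> (\<lambda>n. ?T (x (r n))) \<in> \<Phi> F" if "nbounded E (range x)" for x :: "nat \<Rightarrow> 'a"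
    using that by (intro exI[of _ id]) (simp add: strict_mono_def)
  then show ?thesis
    using T by (simp add: ops_of_seqs_iff)
qed

lemma zero_in_ops:
  assumes E: "banach_space E" and F: "banach_space F"
  shows "(\<lambda>x\<in>carrier E. \<zero>\<^bsub>F\<^esub>) \<in> ops_of_seqs \<Phi> E F"
proof -
  interpret E: banach_space E by fact
  interpret F: banach_space F by fact
  have "bounded_functional E (\<lambda>_. 0)"
    by (auto simp: bounded_functional_def E.nrm_nonneg intro: exI[of _ 1])
  from rank_one_in_ops[OF E F this F.M.zero_closed] show ?thesis
    by (simp add: F.scale_zero_left)
qed

lemma scale_in_ops:
  assumes E: "banach_space E" and F: "banach_space F" and T: "T \<in> ops_of_seqs \<Phi> E F"
  shows "(\<lambda>x\<in>carrier E. a \<odot>\<^bsub>F\<^esub> T x) \<in> ops_of_seqs \<Phi> E F"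
  unfolding ops_of_seqs_iff
proof (intro conjI allI impI)
  have "normed_vspace E" "normed_vspace F" using E F by (simp_all add: banach_space_def)
  then show "(\<lambda>x\<in>carrier E. a \<odot>\<^bsub>F\<^esub> T x) \<in> operators E F"
    using T by (intro scale_in_operators) (simp_all add: ops_of_seqs_iff)
  fix x :: "nat \<Rightarrow> 'a" assume x: "nbounded E (range x)"
  then obtain r where r: "strict_mono r" "(\<lambda>n. T (x (r n))) \<in> \<Phi> F"
    using T by (auto simp: ops_of_seqs_iff)
  have "x n \<in> carrier E" for n using x by (auto simp: nbounded_def)
  then show "\<exists>r. strict_mono r \<and> (\<lambda>n. (\<lambda>x\<in>carrier E. a \<odot>\<^bsub>F\<^esub> T x) (x (r n))) \<in> \<Phi> F"
    using scale_in[OF F r(2), of a] r(1) by auto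
qed

lemma add_in_ops:
  assumes E: "banach_space E" and F: "banach_space F"
    and S: "S \<in> ops_of_seqs \<Phi> E F" and T: "T \<in> ops_of_seqs \<Phi> E F"
  shows "(\<lambda>x\<in>carrier E. S x \<oplus>\<^bsub>F\<^esub> T x) \<in> ops_of_seqs \<Phi> E F"
  unfolding ops_of_seqs_iff
proof (intro conjI allI impI)
  interpret E: banach_space E by fact
  interpret F: banach_space F by fact
  have VE: "normed_vspace E" and VF: "normed_vspace F" by unfold_locales
  have So: "S \<in> operators E F" and To: "T \<in> operators E F"
    using S T by (simp_all add: ops_of_seqs_iff)
  show "(\<lambda>x\<in>carrier E. S x \<oplus>\<^bsub>F\<^esub> T x) \<in> operators E F"
    by (rule add_in_operators[OF VE VF So To])
  fix x :: "nat \<Rightarrow> 'a" assume x: "nbounded E (range x)"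
  then have xc: "x n \<in> carrier E" for n by (auto simp: nbounded_def)
  obtain r where r: "strict_mono r" "(\<lambda>n. S (x (r n))) \<in> \<Phi> F"
    using S x by (auto simp: ops_of_seqs_iff)
  have "nbounded E (range (\<lambda>n. x (r n)))"
    by (rule nbounded_subset[OF x]) auto
  then obtain s where s: "strict_mono s" "(\<lambda>n. T (x (r (s n)))) \<in> \<Phi> F"
    using T unfolding ops_of_seqs_iff by meson
  have "(\<lambda>n. S (x (r (s n))) \<oplus>\<^bsub>F\<^esub> T (x (r (s n)))) \<in> \<Phi> F"
    using combination_in[OF F subseq_in[OF F r(2) s(1)] s(2), of 1 1] xc
    by (simp add: F.scale_one operatorsD[OF So] operatorsD[OF To])
  then show "\<exists>r. strict_mono r \<and> (\<lambda>n. (\<lambda>x\<in>carrier E. S x \<oplus>\<^bsub>F\<^esub> T x) (x (r n))) \<in> \<Phi> F"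
    using xc strict_mono_o[OF r(1) s(1)] by (intro exI[of _ "r \<circ> s"]) simp
qed

lemma ops_submodule:
  assumes E: "banach_space E" and F: "banach_space F"
  shows "submodule (ops_of_seqs \<Phi> E F) scalar_field (operator_space E F)"
proof -
  have VE: "normed_vspace E" and VF: "normed_vspace F"
    using E F by (simp_all add: banach_space_def)
  interpret O: Module.module scalar_field "operator_space E F"
    by (rule operator_space_module[OF VE VF])
  have sub: "ops_of_seqs \<Phi> E F \<subseteq> operators E F"
    by (auto simp: ops_of_seqs_iff)
  show ?thesis
  proof (rule O.submoduleI)
    fix T assume T: "T \<in> ops_of_seqs \<Phi> E F"
    then have Tc: "T \<in> carrier (operator_space E F)" using sub by auto
    have "\<ominus>\<^bsub>scalar_field\<^esub> 1 = (- 1 :: 'k)"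
      by (rule O.R.minus_equality) simp_all
    then have "\<ominus>\<^bsub>operator_space E F\<^esub> T = (- 1) \<odot>\<^bsub>operator_space E F\<^esub> T"
      using O.smult_l_minus[OF _ Tc, of 1] O.smult_one[OF Tc] by simp
    then show "\<ominus>\<^bsub>operator_space E F\<^esub> T \<in> ops_of_seqs \<Phi> E F"
      using scale_in_ops[OF E F T] by simp
  qed (use sub zero_in_ops[OF E F] add_in_ops[OF E F] scale_in_ops[OF E F] in auto)
qed

lemma compose_in_ops:
  assumes E: "banach_space E" and F: "banach_space F"
    and E0: "banach_space E\<^sub>0" and F0: "banach_space F\<^sub>0"
    and R: "R \<in> operators F F\<^sub>0" and T: "T \<in> ops_of_seqs \<Phi> E F" and S: "S \<in> operators E\<^sub>0 E"
  shows "compose (carrier E\<^sub>0) R (compose (carrier E\<^sub>0) T S) \<in> ops_of_seqs \<Phi> E\<^sub>0 F\<^sub>0"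
  unfolding ops_of_seqs_iff
proof (intro conjI allI impI)
  have V: "normed_vspace E" "normed_vspace F" "normed_vspace E\<^sub>0" "normed_vspace F\<^sub>0"
    using E F E0 F0 by (simp_all add: banach_space_def)
  have To: "T \<in> operators E F" using T by (simp add: ops_of_seqs_iff)
  show "compose (carrier E\<^sub>0) R (compose (carrier E\<^sub>0) T S) \<in> operators E\<^sub>0 F\<^sub>0"
    by (intro compose_in_operators[OF V(3) V(2) V(4) R] compose_in_operators[OF V(3) V(1) V(2) To] S)
  fix x :: "nat \<Rightarrow> 'a" assume x: "nbounded E\<^sub>0 (range x)"
  then have xc: "x n \<in> carrier E\<^sub>0" for n by (auto simp: nbounded_def)
  have "nbounded E (range (\<lambda>n. S (x n)))"
    using operator_image_nbounded[OF V(3) V(1) S x] by (simp add: image_image)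
  then obtain r where r: "strict_mono r" "(\<lambda>n. T (S (x (r n)))) \<in> \<Phi> F"
    using T unfolding ops_of_seqs_iff by meson
  obtain s where s: "strict_mono s" "(\<lambda>n. R (T (S (x (r (s n)))))) \<in> \<Phi> F\<^sub>0"
    using operator_subseq_in[OF F F0 R r(2)] by blast
  then show "\<exists>r. strict_mono r \<and>
      (\<lambda>n. compose (carrier E\<^sub>0) R (compose (carrier E\<^sub>0) T S) (x (r n))) \<in> \<Phi> F\<^sub>0"
    using xc strict_mono_o[OF r(1) s(1)] by (intro exI[of _ "r \<circ> s"]) (simp add: compose_def)
qed

lemma surjective_in_ops:
  assumes E: "banach_space E" and E0: "banach_space E\<^sub>0" and F: "banach_space F"
    and T: "T \<in> operators E F" and S: "S \<in> ops_of_seqs \<Phi> E\<^sub>0 F"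
    and sub: "T ` unit_ball E \<subseteq> S ` unit_ball E\<^sub>0"
  shows "T \<in> ops_of_seqs \<Phi> E F"
  unfolding ops_of_seqs_iff
proof (intro conjI allI impI)
  interpret E: banach_space E by fact
  interpret F: banach_space F by fact
  show "T \<in> operators E F" by fact
  fix x :: "nat \<Rightarrow> 'a" assume x: "nbounded E (range x)"
  then have xc: "x n \<in> carrier E" for n by (auto simp: nbounded_def)
  obtain C where C: "C > 0" "\<And>n. nrm E (x n) \<le> C"
  proof -
    \<comment> \<open>A bound need not be positive if the sequence is zero, but \<open>1 / C\<close> has to make sense.\<close>
    obtain D where "\<And>n. nrm E (x n) \<le> D" using x by (auto simp: nbounded_def)
    then show thesis using that[of "max D 1"] by (simp add: le_max_iff_disj)
  qed
  define u where "u n = of_real (1 / C) \<odot>\<^bsub>E\<^esub> x n" for n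
  have "u n \<in> unit_ball E" for n
    using xc C by (simp add: u_def unit_ball_def E.nrm_smult E.scale_closed norm_divide field_simps)
  then have "\<forall>n. \<exists>v. v \<in> unit_ball E\<^sub>0 \<and> T (u n) = S v"
    using sub by blast
  then obtain v where v: "\<And>n. v n \<in> unit_ball E\<^sub>0" "\<And>n. T (u n) = S (v n)"
    by metis
  have "nbounded E\<^sub>0 (range v)"
    using v(1) by (auto simp: nbounded_def unit_ball_def)
  then obtain r where r: "strict_mono r" "(\<lambda>n. S (v (r n))) \<in> \<Phi> F"
    using S by (auto simp: ops_of_seqs_iff)
  have "T (x n) = of_real C \<odot>\<^bsub>F\<^esub> S (v n)" for n
  proof -
    have "x n = of_real C \<odot>\<^bsub>E\<^esub> u n"
      using C xc by (simp add: u_def E.scale_scale E.scale_one)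
    then have "T (x n) = of_real C \<odot>\<^bsub>F\<^esub> T (u n)"
      using operatorsD(4)[OF T, of "u n" "of_real C"] xc by (simp add: u_def E.scale_closed)
    then show ?thesis by (simp add: v)
  qed
  then show "\<exists>r. strict_mono r \<and> (\<lambda>n. T (x (r n))) \<in> \<Phi> F"
    using scale_in[OF F r(2), of "of_real C"] r(1) by auto
qed

lemma ops_of_seqs_eq_ops_of_bornology:
  assumes E: "banach_space E" and F: "banach_space F"
  shows "ops_of_seqs \<Phi> E F = ops_of_bornology (seq_bornology \<Phi>) E F"
proof (intro equalityI subsetI)
  interpret E: banach_space E by fact
  interpret F: banach_space F by fact
  have VE: "normed_vspace E" and VF: "normed_vspace F" by unfold_locales
  fix T assume T: "T \<in> ops_of_seqs \<Phi> E F"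
  then have To: "T \<in> operators E F" by (simp add: ops_of_seqs_iff)
  have "T ` M \<in> seq_bornology \<Phi> F" if M: "nbounded E M" for M
  proof -
    have TM: "nbounded F (T ` M)"
      by (rule operator_image_nbounded[OF VE VF To M])
    have hull: "circle_hull F (T ` M) \<subseteq> T ` circle_hull E M"
    proof
      fix z assume "z \<in> circle_hull F (T ` M)"
      then obtain a x where ax: "x \<in> M" "norm a \<le> 1" "z = a \<odot>\<^bsub>F\<^esub> T x"
        by (auto simp: circle_hull_def)
      then have "z = T (a \<odot>\<^bsub>E\<^esub> x)"
        using M by (auto simp: operatorsD(4)[OF To] nbounded_def)
      then show "z \<in> T ` circle_hull E M"
        using ax by (auto simp: circle_hull_def)
    qed
    have "\<exists>r. strict_mono r \<and> z \<circ> r \<in> \<Phi> F" if z: "range z \<subseteq> circle_hull F (T ` M)" for z :: "nat \<Rightarrow> 'a"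
    proof -
      have "\<forall>n. \<exists>x. x \<in> circle_hull E M \<and> z n = T x"
        using z hull by blast
      then obtain x where x: "\<And>n. x n \<in> circle_hull E M" "\<And>n. z n = T (x n)"
        by metis
      have "nbounded E (range x)"
        using circle_hull_nbounded[OF VE M] by (rule nbounded_subset) (use x in auto)
      then show ?thesis
        using T by (auto simp: ops_of_seqs_iff comp_def x)
    qed
    then show ?thesis
      using TM circle_hull_nbounded[OF VF TM] by (simp add: seq_bornology_def base_bornology_def)
  qed
  then show "T \<in> ops_of_bornology (seq_bornology \<Phi>) E F"
    using To by (simp add: ops_of_bornology_def)
next
  interpret F: banach_space F by fact
  fix T assume "T \<in> ops_of_bornology (seq_bornology \<Phi>) E F"
  then have To: "T \<in> operators E F" and TM: "\<And>M. nbounded E M \<Longrightarrow> T ` M \<in> seq_bornology \<Phi> F"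
    by (simp_all add: ops_of_bornology_def)
  have "\<exists>r. strict_mono r \<and> (\<lambda>n. T (x (r n))) \<in> \<Phi> F" if x: "nbounded E (range x)" for x :: "nat \<Rightarrow> 'a"
  proof -
    have "T (x n) \<in> circle_hull F (T ` range x)" for n
    proof -
      have "x n \<in> carrier E" using x by (auto simp: nbounded_def)
      then have "T (x n) = 1 \<odot>\<^bsub>F\<^esub> T (x n)"
        by (simp add: operatorsD(2)[OF To] F.scale_one)
      then show ?thesis
        unfolding circle_hull_def by (intro CollectI exI[of _ 1] exI[of _ "T (x n)"]) simp
    qed
    then have in_hull: "range (\<lambda>n. T (x n)) \<subseteq> circle_hull F (T ` range x)" by blast
    have subseq: "\<exists>r. strict_mono r \<and> (\<lambda>n. z (r n)) \<in> \<Phi> F"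
      if "range z \<subseteq> circle_hull F (T ` range x)" for z :: "nat \<Rightarrow> 'a"
      using TM[OF x] that by (simp add: seq_bornology_def base_bornology_def comp_def)
    show ?thesis
      by (rule subseq[OF in_hull])
  qed
  then show "T \<in> ops_of_seqs \<Phi> E F"
    using To by (simp add: ops_of_seqs_iff)
qed

text \<open>
  The existence of functionals is a premise because it is the only step in which the real and the
  complex case differ.
\<close>

lemma surjective_operator_ideal_ops:
  assumes functional: "\<And>(E :: ('k, 'a) normed_space) x. \<lbrakk>normed_vspace E; x \<in> carrier E; x \<noteq> \<zero>\<^bsub>E\<^esub>\<rbrakk>
    \<Longrightarrow> \<exists>g. bounded_functional E g \<and> g x \<noteq> 0"
  shows "surjective_operator_ideal (ops_of_seqs \<Phi>)"
proof -
  have nonzero: "ops_of_seqs \<Phi> E F \<noteq> {\<zero>\<^bsub>operator_space E F\<^esub>}"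
    if E: "banach_space E" and F: "banach_space F"
      and E0: "carrier E \<noteq> {\<zero>\<^bsub>E\<^esub>}" and F0: "carrier F \<noteq> {\<zero>\<^bsub>F\<^esub>}" for E F
  proof -
    interpret E: banach_space E by fact
    interpret F: banach_space F by fact
    obtain x where x: "x \<in> carrier E" "x \<noteq> \<zero>\<^bsub>E\<^esub>"
      using E0 E.M.zero_closed by blast
    obtain y where y: "y \<in> carrier F" "y \<noteq> \<zero>\<^bsub>F\<^esub>"
      using F0 F.M.zero_closed by blast
    obtain g where g: "bounded_functional E g" "g x \<noteq> 0"
      using functional[OF E.normed_vspace_axioms x] by blast
    have "nrm F (g x \<odot>\<^bsub>F\<^esub> y) \<noteq> 0"
      using g y by (simp add: F.nrm_smult F.nrm_eq_0_iff)
    then have "g x \<odot>\<^bsub>F\<^esub> y \<noteq> \<zero>\<^bsub>F\<^esub>"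
      using F.nrm_zero by auto
    then have "(\<lambda>x\<in>carrier E. g x \<odot>\<^bsub>F\<^esub> y) \<noteq> \<zero>\<^bsub>operator_space E F\<^esub>"
      using x(1) by (auto dest: fun_cong[of _ _ x])
    then show ?thesis
      using rank_one_in_ops[OF E F g(1) y(1)] by blast
  qed
  show ?thesis
    unfolding surjective_operator_ideal_def operator_ideal_def
  proof (intro conjI allI impI ballI)
    fix E F :: "('k, 'a) normed_space" assume E: "banach_space E" and F: "banach_space F"
    show "submodule (ops_of_seqs \<Phi> E F) scalar_field (operator_space E F)"
      by (rule ops_submodule[OF E F])
    show "ops_of_seqs \<Phi> E F \<noteq> {\<zero>\<^bsub>operator_space E F\<^esub>}"
      if "carrier E \<noteq> {\<zero>\<^bsub>E\<^esub>}" "carrier F \<noteq> {\<zero>\<^bsub>F\<^esub>}"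
      by (rule nonzero[OF E F that])
  next
    fix E F E\<^sub>0 F\<^sub>0 :: "('k, 'a) normed_space" and R T S
    assume "banach_space E" "banach_space F" "banach_space E\<^sub>0" "banach_space F\<^sub>0"
      and "R \<in> operators F F\<^sub>0" "T \<in> ops_of_seqs \<Phi> E F" "S \<in> operators E\<^sub>0 E"
    then show "compose (carrier E\<^sub>0) R (compose (carrier E\<^sub>0) T S) \<in> ops_of_seqs \<Phi> E\<^sub>0 F\<^sub>0"
      by (rule compose_in_ops)
  next
    fix E E\<^sub>0 F :: "('k, 'a) normed_space" and T S
    assume "banach_space E" "banach_space E\<^sub>0" "banach_space F"
      and "T \<in> operators E F" "S \<in> ops_of_seqs \<Phi> E\<^sub>0 F" "T ` unit_ball E \<subseteq> S ` unit_ball E\<^sub>0"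
    then show "T \<in> ops_of_seqs \<Phi> E F"
      by (rule surjective_in_ops)
  qed
qed

end

theorem theorem3p9:
  fixes \<Phi>\<^sub>R :: "(real, 'a) seq_family" and \<Phi>\<^sub>C :: "(complex, 'b) seq_family"
  shows
    "(generating_sequential_structure \<Phi>\<^sub>R \<longrightarrow>
        surjective_operator_ideal (ops_of_seqs \<Phi>\<^sub>R) \<and>
        (\<forall>E F. banach_space E \<longrightarrow> banach_space F \<longrightarrow>
           ops_of_seqs \<Phi>\<^sub>R E F = ops_of_bornology (seq_bornology \<Phi>\<^sub>R) E F)) \<and>
     (generating_sequential_structure \<Phi>\<^sub>C \<longrightarrow>
        surjective_operator_ideal (ops_of_seqs \<Phi>\<^sub>C) \<and>
        (\<forall>E F. banach_space E \<longrightarrow> banach_space F \<longrightarrow>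
           ops_of_seqs \<Phi>\<^sub>C E F = ops_of_bornology (seq_bornology \<Phi>\<^sub>C) E F))"
  by (intro conjI impI allI generating_structure.surjective_operator_ideal_ops
      generating_structure.ops_of_seqs_eq_ops_of_bornology generating_structure.intro
      bounded_functional_real bounded_functional_complex)

end
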